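(* Let $r\ge 2$ and let $\Gamma=\Gamma_1\cup\cdots\cup\Gamma_r$ be the disjoint union of graphs $\Gamma_1,\dots,\Gamma_r$ of orders $n_1,\dots,n_r$, and let $n=n_1+\cdots+n_r$. Then $$A(\Gamma;x)=x^{n-n_1}A(\Gamma_1;x)+\cdots+x^{n-n_r}A(\Gamma_r;x).$$
   Context: All graphs are finite and simple with at least one vertex. The disjoint union of graphs with disjoint vertex sets is the graph whose vertex and edge sets are the unions of theirs. For a graph $\Gamma=(V,E)$ of order $n$, a vertex $v$ and $X\subseteq V$, $\delta_X(v)$ is the number of neighbours of $v$ in $X$, $\delta_1$ the maximum degree, $\bar S=V\setminus S$, and $\mathcal{K}=[-\delta_1,\delta_1]\cap\mathbb{Z}$. A nonempty $S\subseteq V$ is a defensive $k$-alliance if $\delta_S(v)\ge\delta_{\bar S}(v)+k$ for all $v\in S$; its exact index of alliance is $k_S=\max\{k\in\mathcal{K}: S \text{ is a defensive } k\text{-alliance}\}$. The alliance polynomial is $A(\Gamma;x)=\sum_{S} x^{n+k_S}$, the sum over all nonempty $S\subseteq V$ with induced subgraph $\langle S\rangle$ connected. *)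

theory Defs
  imports
    "HOL-Computational_Algebra.Polynomial"
    "HOL-Library.Disjoint_Sets"
    "Graph_Theory.Graph_Theory"
begin

text \<open>
  A finite simple graph is a \<^locale>\<open>pair_graph\<close>: a finite, loop-free digraph without parallel
  arcs whose arc relation is symmetric, so an edge \<open>uv\<close> is the pair of arcs \<open>(u, v)\<close>, \<open>(v, u)\<close>.
  The locale admits the null graph; that \<open>pverts G \<noteq> {}\<close> has to be assumed separately.
\<close>

definition nbrs_in :: "'a pair_pre_digraph \<Rightarrow> 'a set \<Rightarrow> 'a \<Rightarrow> nat" where
  "nbrs_in G X v = card {w \<in> X. (v, w) \<in> parcs G}"

definition max_degree :: "'a pair_pre_digraph \<Rightarrow> nat" where
  "max_degree G = Max ((\<lambda>v. nbrs_in G (pverts G) v) ` pverts G)"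

definition defensive_alliance :: "'a pair_pre_digraph \<Rightarrow> int \<Rightarrow> 'a set \<Rightarrow> bool" where
  "defensive_alliance G k S \<longleftrightarrow> S \<noteq> {} \<and> S \<subseteq> pverts G \<and>
     (\<forall>v\<in>S. int (nbrs_in G S v) \<ge> int (nbrs_in G (pverts G - S) v) + k)"

text \<open>For nonempty \<open>S \<subseteq> pverts G\<close> the set below is finite and contains \<open>- int (max_degree G)\<close>.\<close>

definition exact_index :: "'a pair_pre_digraph \<Rightarrow> 'a set \<Rightarrow> int" where
  "exact_index G S =
     Max {k \<in> {- int (max_degree G) .. int (max_degree G)}. defensive_alliance G k S}"

text \<open>
  The conversion \<^const>\<open>nat\<close> never truncates here, since
  \<open>exact_index G S \<ge> - int (max_degree G) > - int (card (pverts G))\<close>.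
\<close>

definition alliance_poly :: "'a pair_pre_digraph \<Rightarrow> int poly" where
  "alliance_poly G =
     (\<Sum>S | S \<noteq> {} \<and> S \<subseteq> pverts G \<and> Digraph_Component.connected (with_proj G \<restriction> S).
        monom 1 (nat (int (card (pverts G)) + exact_index G S)))"

text \<open>Meant for families of graphs with pairwise disjoint vertex sets.\<close>

definition graph_Union :: "(nat \<Rightarrow> 'a pair_pre_digraph) \<Rightarrow> nat set \<Rightarrow> 'a pair_pre_digraph" where
  "graph_Union G I = \<lparr> pverts = (\<Union>i\<in>I. pverts (G i)), parcs = (\<Union>i\<in>I. parcs (G i)) \<rparr>"

end

theory Submission
  imports Defs
begin

text \<open>
  A connected vertex set of a disjoint union lies inside a single component, and there its
  neighbour counts are those of the component. The exact index of a nonempty \<open>S\<close> is the minimum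
  over \<open>v \<in> S\<close> of \<open>\<delta>\<^sub>S(v)\<close> minus the degree of \<open>v\<close> into the complement of \<open>S\<close>; the maximum degree,
  which does differ between component and union, drops out. Hence each term of the alliance
  polynomial of a component is only shifted by the difference of the orders.
\<close>

lemma nbrs_in_le_max_degree:
  assumes "finite (pverts G)" "v \<in> pverts G" "X \<subseteq> pverts G"
  shows "nbrs_in G X v \<le> max_degree G"
proof -
  have "nbrs_in G X v \<le> nbrs_in G (pverts G) v"
    unfolding nbrs_in_def using assms by (intro card_mono) auto
  also have "\<dots> \<le> max_degree G"
    unfolding max_degree_def using assms by (intro Max_ge) auto
  finally show ?thesis .
qed

lemma nbrs_in_le_card:
  assumes "finite X"
  shows "nbrs_in G X v \<le> card X"
  unfolding nbrs_in_def using assms by (intro card_mono) auto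

text \<open>Both neighbour counts are at most \<open>max_degree G\<close>, so every difference lies
  in the range over which \<open>exact_index\<close> maximises. The admissible \<open>k\<close> are
  therefore exactly the integers from the lower end of that range up to the least
  difference.\<close>

lemma exact_index_eq_Min:
  assumes fin: "finite (pverts G)" and S: "S \<noteq> {}" "S \<subseteq> pverts G"
  shows "exact_index G S =
           Min ((\<lambda>v. int (nbrs_in G S v) - int (nbrs_in G (pverts G - S) v)) ` S)"
    (is "_ = Min (?f ` S)")
proof -
  have fS: "finite (?f ` S)" "?f ` S \<noteq> {}"
    using assms by (auto intro: finite_subset)
  have bounds: "?f v \<in> {- int (max_degree G) .. int (max_degree G)}" if "v \<in> S" for v
    using nbrs_in_le_max_degree[OF fin, of v S] nbrs_in_le_max_degree[OF fin, of v "pverts G - S"]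
      that S by auto
  define M where "M = Min (?f ` S)"
  have M: "M \<in> {- int (max_degree G) .. int (max_degree G)}"
    unfolding M_def by (rule imageE[OF Min_in[OF fS]]) (simp only: bounds)
  have "defensive_alliance G k S \<longleftrightarrow> k \<le> M" for k
    unfolding M_def Min_ge_iff[OF fS] using S
    by (simp add: defensive_alliance_def le_diff_eq add.commute)
  then have "{k \<in> {- int (max_degree G) .. int (max_degree G)}. defensive_alliance G k S}
               = {- int (max_degree G) .. M}"
    using M by (intro set_eqI) (simp, linarith)
  then have "exact_index G S = M"
    unfolding exact_index_def using M by (intro Max_eqI) simp_all
  then show ?thesis
    by (simp only: M_def)
qed

text \<open>Makes the exponent in \<open>alliance_poly\<close> nonnegative before \<open>nat\<close>
  is applied, so that \<open>nat\<close> commutes with adding the number of vertices outside a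
  component.\<close>

lemma exact_index_ge_neg_card:
  assumes fin: "finite (pverts G)" and S: "S \<noteq> {}" "S \<subseteq> pverts G"
  shows "- int (card (pverts G)) \<le> exact_index G S"
proof -
  have "int (nbrs_in G (pverts G - S) v) \<le> int (card (pverts G))" for v
    using nbrs_in_le_card[of "pverts G - S" G v] card_mono[of "pverts G" "pverts G - S"] fin
    by simp
  then have "- int (card (pverts G)) \<le> int (nbrs_in G S v) - int (nbrs_in G (pverts G - S) v)" for v
    by (smt (verit) of_nat_0_le_iff)
  then show ?thesis
    unfolding exact_index_eq_Min[OF assms] using fin S
    by (subst Min_ge_iff) (auto intro: finite_subset)
qed

lemma pverts_graph_Union: "pverts (graph_Union G I) = (\<Union>i\<in>I. pverts (G i))"
  and parcs_graph_Union: "parcs (graph_Union G I) = (\<Union>i\<in>I. parcs (G i))"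
  by (simp_all add: graph_Union_def)

text \<open>Well-formedness keeps both ends of an arc in the vertex set of its own graph; with
  disjointness, the graph that an arc belongs to can be read off from either end.\<close>

locale disjoint_digraph_family =
  fixes G :: "nat \<Rightarrow> 'a pair_pre_digraph" and I :: "nat set"
  assumes wf: "i \<in> I \<Longrightarrow> pair_wf_digraph (G i)"
    and disj: "disjoint_family_on (\<lambda>i. pverts (G i)) I"
begin

lemma index_unique:
  assumes "i \<in> I" "j \<in> I" "v \<in> pverts (G i)" "v \<in> pverts (G j)"
  shows "i = j"
  using assms disj by (auto simp: disjoint_family_on_def)

lemma parcs_imp_pverts:
  assumes "i \<in> I" "(u, v) \<in> parcs (G i)"
  shows "u \<in> pverts (G i)" "v \<in> pverts (G i)"
  using pair_wf_digraph.in_arcsD1[OF wf[OF assms(1)] assms(2)]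
    pair_wf_digraph.in_arcsD2[OF wf[OF assms(1)] assms(2)] by simp_all

text \<open>One endpoint suffices: an arc of the union comes from some \<open>G j\<close>, which
  contains both its ends, so disjointness gives \<open>i = j\<close>. The disjunction allows for
  arcs traversed in either direction in the connectivity argument.\<close>

lemma parcs_graph_Union_iff:
  assumes "i \<in> I" "u \<in> pverts (G i) \<or> v \<in> pverts (G i)"
  shows "(u, v) \<in> parcs (graph_Union G I) \<longleftrightarrow> (u, v) \<in> parcs (G i)"
proof
  assume "(u, v) \<in> parcs (graph_Union G I)"
  then obtain j where j: "j \<in> I" "(u, v) \<in> parcs (G j)"
    unfolding parcs_graph_Union by (rule UN_E)
  then have "i = j"
    using assms(2) parcs_imp_pverts[OF j] index_unique[OF assms(1) j(1)] by blast
  with j show "(u, v) \<in> parcs (G i)"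
    by simp
next
  assume "(u, v) \<in> parcs (G i)"
  then show "(u, v) \<in> parcs (graph_Union G I)"
    unfolding parcs_graph_Union by (rule UN_I[OF assms(1)])
qed

text \<open>All neighbours of \<open>v\<close> lie in \<open>G i\<close>. The set \<open>X\<close>
  is arbitrary so that it can also be the complement of \<open>S\<close> in the whole union, which
  leaves the component.\<close>

lemma nbrs_in_graph_Union:
  assumes "i \<in> I" "v \<in> pverts (G i)"
  shows "nbrs_in (graph_Union G I) X v = nbrs_in (G i) (X \<inter> pverts (G i)) v"
proof -
  have "{w \<in> X. (v, w) \<in> parcs (graph_Union G I)}
          = {w \<in> X \<inter> pverts (G i). (v, w) \<in> parcs (G i)}"
    using parcs_graph_Union_iff assms parcs_imp_pverts by blast
  then show ?thesis
    by (simp only: nbrs_in_def)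
qed

lemma exact_index_graph_Union:
  assumes fin: "finite (pverts (graph_Union G I))"
    and i: "i \<in> I" and S: "S \<noteq> {}" "S \<subseteq> pverts (G i)"
  shows "exact_index (graph_Union G I) S = exact_index (G i) S"
proof -
  let ?U = "graph_Union G I"
  have sub: "pverts (G i) \<subseteq> pverts ?U"
    unfolding pverts_graph_Union by (rule UN_upper[OF i])
  \<comment> \<open>The two complements of \<open>S\<close> differ only by vertices of other
    components, which the intersection removes.\<close>
  have "S \<inter> pverts (G i) = S" "(pverts ?U - S) \<inter> pverts (G i) = pverts (G i) - S"
    using S sub by blast+
  then have "nbrs_in ?U S v = nbrs_in (G i) S v \<and>
      nbrs_in ?U (pverts ?U - S) v = nbrs_in (G i) (pverts (G i) - S) v" if "v \<in> S" for v
    using nbrs_in_graph_Union[OF i, of v] subsetD[OF S(2) that]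
    by simp
  then have "(\<lambda>v. int (nbrs_in ?U S v) - int (nbrs_in ?U (pverts ?U - S) v)) ` S
      = (\<lambda>v. int (nbrs_in (G i) S v) - int (nbrs_in (G i) (pverts (G i) - S) v)) ` S"
    by (intro image_cong) simp_all
  then show ?thesis
    unfolding exact_index_eq_Min[OF fin S(1) subset_trans[OF S(2) sub]]
      exact_index_eq_Min[OF finite_subset[OF sub fin] S] by (rule arg_cong)
qed

lemma induce_subgraph_graph_Union:
  assumes "i \<in> I" "S \<subseteq> pverts (G i)"
  shows "with_proj (graph_Union G I) \<restriction> S = with_proj (G i) \<restriction> S"
proof -
  have "{e \<in> parcs (graph_Union G I). fst e \<in> S \<and> snd e \<in> S}
          = {e \<in> parcs (G i). fst e \<in> S \<and> snd e \<in> S}"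
    using parcs_graph_Union_iff[OF assms(1)] subsetD[OF assms(2)]
    by (intro Collect_cong) (metis prod.collapse)
  then show ?thesis
    by (simp add: induce_subgraph_def)
qed

text \<open>Connectedness is strong connectivity of the symmetric closure. A walk from a fixed
  \<open>u\<close> in \<open>S\<close> never leaves the component of \<open>u\<close>, since no arc
  joins two components.\<close>

lemma connected_imp_subset_component:
  assumes conn: "Digraph_Component.connected (with_proj (graph_Union G I) \<restriction> S)"
    and S: "S \<subseteq> pverts (graph_Union G I)"
  obtains i where "i \<in> I" "S \<subseteq> pverts (G i)"
proof -
  let ?H = "mk_symmetric (with_proj (graph_Union G I) \<restriction> S)"
  have sc: "strongly_connected ?H"
    using conn by (simp add: Digraph_Component.connected_def)
  \<comment> \<open>Strong connectivity includes that the vertex set is nonempty.\<close>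
  then obtain u where u: "u \<in> S"
    by (auto simp: strongly_connected_def)
  then obtain i where i: "i \<in> I" "u \<in> pverts (G i)"
    using S by (auto simp: pverts_graph_Union)
  have "w \<in> pverts (G i)" if "w \<in> S" for w
  proof -
    have "(u, w) \<in> rtrancl_on S (parcs ?H)"
      using sc u that by (simp add: strongly_connected_def reachable_def)
    then show ?thesis
    proof (induction rule: rtrancl_on_induct)
      case base
      show ?case by (rule i(2))
    next
      case (step y z)
      \<comment> \<open>A step of the walk may be the reverse of an arc of the union, because of the
        symmetric closure.\<close>
      then have "(y, z) \<in> parcs (graph_Union G I) \<or> (z, y) \<in> parcs (graph_Union G I)"
        by (auto simp: parcs_mk_symmetric)
      then have "(y, z) \<in> parcs (G i) \<or> (z, y) \<in> parcs (G i)"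
        using parcs_graph_Union_iff[OF i(1)] step by blast
      then show ?case
        using parcs_imp_pverts[OF i(1)] by blast
    qed
  qed
  then show thesis
    using that i(1) by blast
qed

text \<open>The subgraph induced on \<open>S\<close> is the same in the union as in its component,
  which carries connectedness over in both directions.\<close>

lemma connected_sets_graph_Union:
  "{S. S \<noteq> {} \<and> S \<subseteq> pverts (graph_Union G I)
        \<and> Digraph_Component.connected (with_proj (graph_Union G I) \<restriction> S)}
   = (\<Union>i\<in>I. {S. S \<noteq> {} \<and> S \<subseteq> pverts (G i) \<and> Digraph_Component.connected (with_proj (G i) \<restriction> S)})"
    (is "?L = ?R")
proof (rule set_eqI)
  fix S
  show "S \<in> ?L \<longleftrightarrow> S \<in> ?R"
  proof
    assume L: "S \<in> ?L"
    then obtain i where "i \<in> I" "S \<subseteq> pverts (G i)"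
      using connected_imp_subset_component by blast
    with L show "S \<in> ?R"
      by (auto simp: induce_subgraph_graph_Union)
  next
    assume "S \<in> ?R"
    then show "S \<in> ?L"
      by (auto simp: induce_subgraph_graph_Union pverts_graph_Union)
  qed
qed

theorem alliance_poly_graph_Union:
  assumes "finite I" and fin: "\<And>i. i \<in> I \<Longrightarrow> finite (pverts (G i))"
  shows "alliance_poly (graph_Union G I) =
    (\<Sum>i\<in>I. monom 1 (card (pverts (graph_Union G I)) - card (pverts (G i))) * alliance_poly (G i))"
proof -
  let ?U = "graph_Union G I"
  let ?C = "\<lambda>H. {S. S \<noteq> {} \<and> S \<subseteq> pverts H \<and> Digraph_Component.connected (with_proj H \<restriction> S)}"
  let ?t = "\<lambda>H S. monom 1 (nat (int (card (pverts H)) + exact_index H S)) :: int poly"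
  have finU: "finite (pverts ?U)"
    using assms by (simp add: pverts_graph_Union)
  have shift: "?t ?U S = monom 1 (card (pverts ?U) - card (pverts (G i))) * ?t (G i) S"
    if i: "i \<in> I" and S: "S \<in> ?C (G i)" for i S
  proof -
    have "card (pverts (G i)) \<le> card (pverts ?U)"
      using i by (intro card_mono finU) (auto simp: pverts_graph_Union)
    moreover have "- int (card (pverts (G i))) \<le> exact_index (G i) S"
      using S by (intro exact_index_ge_neg_card fin i) auto
    \<comment> \<open>The two preceding bounds rule out truncation, in the natural subtraction and
      in \<open>nat\<close>, so the exponents really add up.\<close>
    ultimately have "nat (int (card (pverts ?U)) + exact_index (G i) S)
        = card (pverts ?U) - card (pverts (G i)) + nat (int (card (pverts (G i))) + exact_index (G i) S)"
      by linarith
    then show ?thesis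
      using S exact_index_graph_Union[OF finU i] by (simp add: mult_monom)
  qed
  have "alliance_poly ?U = sum (?t ?U) (\<Union>i\<in>I. ?C (G i))"
    unfolding alliance_poly_def connected_sets_graph_Union ..
  also have "\<dots> = (\<Sum>i\<in>I. sum (?t ?U) (?C (G i)))"
  proof (rule sum.UNION_disjoint)
    show "\<forall>i\<in>I. finite (?C (G i))"
      using fin by simp
    \<comment> \<open>A common member would be a nonempty set inside two disjoint vertex
      sets.\<close>
    show "\<forall>i\<in>I. \<forall>j\<in>I. i \<noteq> j \<longrightarrow> ?C (G i) \<inter> ?C (G j) = {}"
      using index_unique by blast
  qed fact
  also have "\<dots> = (\<Sum>i\<in>I. monom 1 (card (pverts ?U) - card (pverts (G i))) * alliance_poly (G i))"
    unfolding alliance_poly_def sum_distrib_left by (intro sum.cong refl shift)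
  finally show ?thesis .
qed

end

theorem theorem2p8:
  fixes G :: "nat \<Rightarrow> 'a pair_pre_digraph" and r :: nat and m :: "nat \<Rightarrow> nat" and n :: nat
  assumes "r \<ge> 2"
    and "\<And>i. i \<in> {1..r} \<Longrightarrow> pair_graph (G i)"
    and "\<And>i. i \<in> {1..r} \<Longrightarrow> pverts (G i) \<noteq> {}"
    and "disjoint_family_on (\<lambda>i. pverts (G i)) {1..r}"
    and "\<And>i. i \<in> {1..r} \<Longrightarrow> m i = card (pverts (G i))"
    and "n = (\<Sum>i=1..r. m i)"
  shows "alliance_poly (graph_Union G {1..r})
           = (\<Sum>i=1..r. monom 1 (n - m i) * alliance_poly (G i))"
proof -
  have fin: "finite (pverts (G i))" and wf: "pair_wf_digraph (G i)" if "i \<in> {1..r}" for i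
  proof -
    interpret pair_graph "G i"
      using assms(2) that .
    show "finite (pverts (G i))" by (rule pair_finite_verts)
    show "pair_wf_digraph (G i)" by (rule pair_wf_digraph)
  qed
  interpret disjoint_digraph_family G "{1..r}"
    by (intro disjoint_digraph_family.intro wf assms(4))
  have "card (pverts (graph_Union G {1..r})) = (\<Sum>i=1..r. card (pverts (G i)))"
    unfolding pverts_graph_Union using fin assms(4)
    by (intro card_UN_disjoint) (auto simp: disjoint_family_on_def)
  also have "\<dots> = n"
    using assms(5,6) by simp
  finally show ?thesis
    using alliance_poly_graph_Union fin assms(5) by simp
qed

end
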